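(* Let $n$ and $m$ be integers with $n \geq 3$ and $0 < m < n$. Then every variety with an $n$-ary exact-$m$-majority term is congruence modular.
   Context: Varieties are varieties (equational classes) of algebras in the sense of universal algebra. For integers $0<m\leq n$, an $n$-ary term $u$ (in the language of the algebra or variety under consideration) is an exact-$m$-majority term, in some algebra or some variety, if the equation $u(x_1, x_2, \dots, x_n) = x$ holds in it whenever only the (distinct) variables $x$ and $y$ occur in $\{x_1, x_2, \dots, x_n\}$ and the set $\{\, i \leq n \mid x_i = x \,\}$ has exactly $m$ elements. (Equations are universally quantified, so the values assigned to $x$ and $y$ are allowed to coincide.) A variety is congruence modular if the congruence lattice of each of its algebras is a modular lattice. *)

theory Defs
  imports "HOL-Algebra.Lattice"
begin

datatype ('f, 'v) uterm = Var 'v | App 'f "('f, 'v) uterm list"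

text \<open>Throughout, \<open>ar\<close> assigns to each operation symbol its arity; an arbitrary similarity
  type is given by an arbitrary type \<open>'f\<close> of symbols together with \<open>ar\<close>.\<close>

fun wf_term :: "('f \<Rightarrow> nat) \<Rightarrow> ('f, 'v) uterm \<Rightarrow> bool" where
  "wf_term ar (Var x) \<longleftrightarrow> True"
| "wf_term ar (App f ts) \<longleftrightarrow> length ts = ar f \<and> (\<forall>t\<in>set ts. wf_term ar t)"

fun term_vars :: "('f, 'v) uterm \<Rightarrow> 'v set" where
  "term_vars (Var x) = {x}"
| "term_vars (App f ts) = (\<Union>t\<in>set ts. term_vars t)"

fun term_subst :: "('v \<Rightarrow> ('f, 'w) uterm) \<Rightarrow> ('f, 'v) uterm \<Rightarrow> ('f, 'w) uterm" where
  "term_subst \<sigma> (Var x) = \<sigma> x"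
| "term_subst \<sigma> (App f ts) = App f (map (term_subst \<sigma>) ts)"

record ('a, 'f) ualgebra = "'a partial_object" +
  opn :: "'f \<Rightarrow> 'a list \<Rightarrow> 'a"

text \<open>Only the values of \<open>opn A f\<close> on lists of length \<open>ar f\<close> over the carrier matter.\<close>

definition is_ualgebra :: "('f \<Rightarrow> nat) \<Rightarrow> ('a, 'f) ualgebra \<Rightarrow> bool" where
  "is_ualgebra ar A \<longleftrightarrow> carrier A \<noteq> {} \<and>
     (\<forall>f xs. length xs = ar f \<and> set xs \<subseteq> carrier A \<longrightarrow> opn A f xs \<in> carrier A)"

fun term_val :: "('a, 'f) ualgebra \<Rightarrow> ('v \<Rightarrow> 'a) \<Rightarrow> ('f, 'v) uterm \<Rightarrow> 'a" where
  "term_val A \<alpha> (Var x) = \<alpha> x"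
| "term_val A \<alpha> (App f ts) = opn A f (map (term_val A \<alpha>) ts)"

definition holds_eq :: "('a, 'f) ualgebra \<Rightarrow> ('f, 'v) uterm \<Rightarrow> ('f, 'v) uterm \<Rightarrow> bool" where
  "holds_eq A s t \<longleftrightarrow> (\<forall>\<alpha>. range \<alpha> \<subseteq> carrier A \<longrightarrow> term_val A \<alpha> s = term_val A \<alpha> t)"

text \<open>A variety is the class of all models of some set of equations in countably many variables.
  The class is represented by its members whose carrier is a set of elements of the type \<open>'a\<close>;
  since \<open>'a\<close> is arbitrary, theorems about all such \<open>V\<close> cover algebras of every size.\<close>

definition variety :: "('f \<Rightarrow> nat) \<Rightarrow> ('a, 'f) ualgebra set \<Rightarrow> bool" where
  "variety ar V \<longleftrightarrow> (\<exists>E :: (('f, nat) uterm \<times> ('f, nat) uterm) set.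
     (\<forall>(s, t)\<in>E. wf_term ar s \<and> wf_term ar t) \<and>
     V = {A. is_ualgebra ar A \<and> (\<forall>(s, t)\<in>E. holds_eq A s t)})"

text \<open>An \<open>n\<close>-ary term is a term in the variables \<open>0, \<dots>, n - 1\<close>.\<close>

definition nary_term :: "('f \<Rightarrow> nat) \<Rightarrow> nat \<Rightarrow> ('f, nat) uterm \<Rightarrow> bool" where
  "nary_term ar n u \<longleftrightarrow> wf_term ar u \<and> term_vars u \<subseteq> {..<n}"

text \<open>Here \<open>x\<close> and \<open>y\<close> are distinct variables and \<open>v i\<close> is the variable put at place \<open>i\<close>; the
  values assigned to \<open>x\<close> and \<open>y\<close> are unrestricted.\<close>

definition exact_majority_in ::
    "nat \<Rightarrow> nat \<Rightarrow> ('f, nat) uterm \<Rightarrow> ('a, 'f) ualgebra \<Rightarrow> bool" where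
  "exact_majority_in m n u A \<longleftrightarrow>
     (\<forall>(x::nat) (y::nat) (v::nat \<Rightarrow> nat).
        x \<noteq> y \<and> (\<forall>i<n. v i \<in> {x, y}) \<and> card {i. i < n \<and> v i = x} = m \<longrightarrow>
        holds_eq A (term_subst (\<lambda>i. Var (v i)) u) (Var x))"

definition exact_majority_term ::
    "('f \<Rightarrow> nat) \<Rightarrow> nat \<Rightarrow> nat \<Rightarrow> ('f, nat) uterm \<Rightarrow> ('a, 'f) ualgebra set \<Rightarrow> bool" where
  "exact_majority_term ar m n u V \<longleftrightarrow> nary_term ar n u \<and> (\<forall>A\<in>V. exact_majority_in m n u A)"

definition is_congruence :: "('f \<Rightarrow> nat) \<Rightarrow> ('a, 'f) ualgebra \<Rightarrow> ('a \<times> 'a) set \<Rightarrow> bool" where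
  "is_congruence ar A \<theta> \<longleftrightarrow> equiv (carrier A) \<theta> \<and>
     (\<forall>f xs ys. length xs = ar f \<and> list_all2 (\<lambda>x y. (x, y) \<in> \<theta>) xs ys \<longrightarrow>
        (opn A f xs, opn A f ys) \<in> \<theta>)"

definition Con :: "('f \<Rightarrow> nat) \<Rightarrow> ('a, 'f) ualgebra \<Rightarrow> ('a \<times> 'a) set gorder" where
  "Con ar A = \<lparr>carrier = {\<theta>. is_congruence ar A \<theta>}, eq = (=), le = (\<subseteq>)\<rparr>"

locale modular_lattice = lattice L for L (structure) +
  assumes modular: "\<lbrakk>x \<in> carrier L; y \<in> carrier L; z \<in> carrier L; x \<sqsubseteq> z\<rbrakk>
    \<Longrightarrow> x \<squnion> (y \<sqinter> z) = (x \<squnion> y) \<sqinter> z"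

definition congruence_modular :: "('f \<Rightarrow> nat) \<Rightarrow> ('a, 'f) ualgebra set \<Rightarrow> bool" where
  "congruence_modular ar V \<longleftrightarrow> (\<forall>A\<in>V. modular_lattice (Con ar A))"

end

theory Submission
  imports Defs
begin

text \<open>Put \<open>k = n - m\<close> and let \<open>t\<^sub>s\<^sub>,\<^sub>r(x, y, z)\<close> be \<open>u\<close> with \<open>x\<close> at the places below \<open>s\<close>, \<open>y\<close> at the
  places from \<open>s\<close> up to \<open>r\<close>, and \<open>z\<close> elsewhere. Whenever \<open>y\<close> occupies exactly \<open>k\<close> places, exactly
  \<open>m\<close> places are left for the two outer variables, so \<open>t(x, y, x) = x\<close>. Hence the terms
  \<open>d\<^sub>i = t\<^sub>s\<^sub>,\<^sub>s\<^sub>+\<^sub>k\<close> with \<open>s = m - i k\<close>, for \<open>i = 1, \<dots>, m div k\<close>, followed by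
  \<open>p = t\<^sub>r\<^sub>,\<^sub>k\<close> with \<open>r = m mod k\<close>, are directed Gumm terms:
  \<open>d\<^sub>1(x, x, z) = x\<close>, \<open>d\<^sub>i(x, y, x) = x\<close>, \<open>d\<^sub>i(x, z, z) = d\<^sub>i\<^sub>+\<^sub>1(x, x, z)\<close>, the last \<open>d\<^sub>i(x, z, z)\<close> equals
  \<open>p(x, z, z)\<close>, and \<open>p(x, x, z) = z\<close>. They yield the shifting lemma not only for congruences but
  for tolerances, from which modularity follows by approximating the join of \<open>\<beta>\<close> and \<open>\<theta>\<close> by the
  tolerances \<open>R\<^sub>0 = \<beta>\<close>, \<open>R\<^sub>j\<^sub>+\<^sub>1 = R\<^sub>j O \<theta> O R\<^sub>j\<close>.\<close>

section \<open>Tolerances\<close>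

definition tolerance :: "('f \<Rightarrow> nat) \<Rightarrow> ('a, 'f) ualgebra \<Rightarrow> ('a \<times> 'a) set \<Rightarrow> bool" where
  "tolerance ar A R \<longleftrightarrow> R \<subseteq> carrier A \<times> carrier A \<and> refl_on (carrier A) R \<and> sym R \<and>
     (\<forall>f xs ys. length xs = ar f \<and> list_all2 (\<lambda>x y. (x, y) \<in> R) xs ys \<longrightarrow>
        (opn A f xs, opn A f ys) \<in> R)"

lemma is_congruence_iff: "is_congruence ar A \<theta> \<longleftrightarrow> tolerance ar A \<theta> \<and> trans \<theta>"
  unfolding is_congruence_def tolerance_def equiv_def by auto

lemma tolerance_opn:
  "\<lbrakk>tolerance ar A R; length xs = ar f; list_all2 (\<lambda>x y. (x, y) \<in> R) xs ys\<rbrakk>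
    \<Longrightarrow> (opn A f xs, opn A f ys) \<in> R"
  unfolding tolerance_def by blast

lemma tolerance_refl: "tolerance ar A R \<Longrightarrow> x \<in> carrier A \<Longrightarrow> (x, x) \<in> R"
  unfolding tolerance_def refl_on_def by blast

lemma tolerance_sym: "tolerance ar A R \<Longrightarrow> (x, y) \<in> R \<Longrightarrow> (y, x) \<in> R"
  unfolding tolerance_def by (blast dest: symD)

lemma tolerance_carrier:
  "tolerance ar A R \<Longrightarrow> (x, y) \<in> R \<Longrightarrow> x \<in> carrier A \<and> y \<in> carrier A"
  unfolding tolerance_def by blast

lemma tolerance_term_val:
  assumes "tolerance ar A R" and "wf_term ar t" and "\<And>i. (\<sigma> i, \<tau> i) \<in> R"
  shows "(term_val A \<sigma> t, term_val A \<tau> t) \<in> R"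
  using assms(2)
proof (induction t)
  case (Var x)
  then show ?case using assms(3) by simp
next
  case (App f ts)
  then have "list_all2 (\<lambda>x y. (x, y) \<in> R) (map (term_val A \<sigma>) ts) (map (term_val A \<tau>) ts)"
    by (simp add: list_all2_conv_all_nth)
  then show ?case using App.prems tolerance_opn[OF assms(1)] by simp
qed

lemma list_all2_relcompE:
  assumes "list_all2 (\<lambda>x y. (x, y) \<in> R O S) xs zs"
  obtains ys where "list_all2 (\<lambda>x y. (x, y) \<in> R) xs ys" "list_all2 (\<lambda>x y. (x, y) \<in> S) ys zs"
proof -
  have "(\<lambda>x y. (x, y) \<in> R O S) = (\<lambda>x y. (x, y) \<in> R) OO (\<lambda>x y. (x, y) \<in> S)"
    by (auto simp: fun_eq_iff)
  then show ?thesis using assms that by (auto simp: list.rel_compp)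
qed

text \<open>The palindromic shape keeps the composite symmetric, which \<open>R O S\<close> alone
  need not be.\<close>

lemma tolerance_relcomp_sandwich:
  assumes R: "tolerance ar A R" and S: "tolerance ar A S"
  shows "tolerance ar A (R O S O R)"
  unfolding tolerance_def
proof (intro conjI allI impI)
  show "R O S O R \<subseteq> carrier A \<times> carrier A"
    using tolerance_carrier[OF R] by blast
  show "refl_on (carrier A) (R O S O R)"
    using tolerance_refl[OF R] tolerance_refl[OF S] by (blast intro: refl_onI)
  show "sym (R O S O R)"
    using tolerance_sym[OF R] tolerance_sym[OF S] by (blast intro: symI)
next
  fix f xs ys
  assume *: "length xs = ar f \<and> list_all2 (\<lambda>x y. (x, y) \<in> R O S O R) xs ys"
  then obtain us vs where "list_all2 (\<lambda>x y. (x, y) \<in> R) xs us"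
      "list_all2 (\<lambda>x y. (x, y) \<in> S) us vs" "list_all2 (\<lambda>x y. (x, y) \<in> R) vs ys"
    by (elim conjE list_all2_relcompE) blast
  moreover from this * have "length us = ar f" "length vs = ar f"
    by (auto dest!: list_all2_lengthD)
  ultimately show "(opn A f xs, opn A f ys) \<in> R O S O R"
    using * tolerance_opn[OF R] tolerance_opn[OF S] by blast
qed

text \<open>Lists are finite, so the indices involved have a maximum, and monotonicity puts every
  pair into that one member of the chain.\<close>

lemma list_all2_chain_Union:
  fixes R :: "nat \<Rightarrow> ('a \<times> 'a) set"
  assumes "mono R" and "list_all2 (\<lambda>x y. (x, y) \<in> (\<Union>j. R j)) xs ys"
  shows "\<exists>j. list_all2 (\<lambda>x y. (x, y) \<in> R j) xs ys"
  using assms(2)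
proof (induction rule: list_all2_induct)
  case Nil
  then show ?case by simp
next
  case (Cons x xs y ys)
  then obtain i j where "(x, y) \<in> R i" "list_all2 (\<lambda>x y. (x, y) \<in> R j) xs ys" by blast
  moreover have "R i \<subseteq> R (max i j)" "R j \<subseteq> R (max i j)"
    by (simp_all add: monoD[OF assms(1)])
  ultimately have "list_all2 (\<lambda>x y. (x, y) \<in> R (max i j)) (x # xs) (y # ys)"
    by (auto elim: list_all2_mono)
  then show ?case by blast
qed

lemma tolerance_chain_Union:
  fixes R :: "nat \<Rightarrow> ('a \<times> 'a) set"
  assumes "mono R" and tol: "\<And>j. tolerance ar A (R j)"
  shows "tolerance ar A (\<Union>j. R j)"
  unfolding tolerance_def
proof (intro conjI allI impI)
  show "(\<Union>j. R j) \<subseteq> carrier A \<times> carrier A"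
    using tol unfolding tolerance_def by blast
  show "refl_on (carrier A) (\<Union>j. R j)"
    by (auto intro!: refl_onI tolerance_refl[OF tol])
  show "sym (\<Union>j. R j)"
    by (auto intro!: symI intro: tolerance_sym[OF tol])
next
  fix f xs ys
  assume *: "length xs = ar f \<and> list_all2 (\<lambda>x y. (x, y) \<in> (\<Union>j. R j)) xs ys"
  then obtain j where "list_all2 (\<lambda>x y. (x, y) \<in> R j) xs ys"
    using list_all2_chain_Union[OF assms(1)] by blast
  then have "(opn A f xs, opn A f ys) \<in> R j"
    using * by (intro tolerance_opn[OF tol]) simp_all
  then show "(opn A f xs, opn A f ys) \<in> (\<Union>j. R j)" by blast
qed

section \<open>The shifting lemma\<close>

text \<open>With \<open>s = t\<close> the middle block is empty and its argument has no influence,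
  so \<open>block_val A u s s x z z\<close> serves as the normal form for two blocks meeting at
  \<open>s\<close>.\<close>

definition block_val ::
    "('a, 'f) ualgebra \<Rightarrow> ('f, nat) uterm \<Rightarrow> nat \<Rightarrow> nat \<Rightarrow> 'a \<Rightarrow> 'a \<Rightarrow> 'a \<Rightarrow> 'a" where
  "block_val A u s t x y z = term_val A (\<lambda>i. if i < s then x else if i < t then y else z) u"

lemma tolerance_block_val:
  assumes "tolerance ar A R" "wf_term ar u" "(x, x') \<in> R" "(y, y') \<in> R" "(z, z') \<in> R"
  shows "(block_val A u s t x y z, block_val A u s t x' y' z') \<in> R"
  unfolding block_val_def by (rule tolerance_term_val[OF assms(1,2)]) (use assms in auto)

lemma block_val_collapse_left:
  assumes "s \<le> t"
  shows "block_val A u s t x x z = block_val A u t t x z z"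
proof -
  have "(\<lambda>i. if i < s then x else if i < t then x else z) =
      (\<lambda>i. if i < t then x else if i < t then z else z)"
    using assms by auto
  then show ?thesis by (simp add: block_val_def)
qed

lemma block_val_collapse_right: "block_val A u s t x z z = block_val A u s s x z z"
  by (simp add: block_val_def cong: if_cong)

lemma term_val_subst_Var: "term_val A \<alpha> (term_subst (\<lambda>i. Var (v i)) t) = term_val A (\<alpha> \<circ> v) t"
  by (induction t) (auto simp: comp_def cong: map_cong)

lemma exact_majority_val:
  assumes "exact_majority_in m n u A" and "x \<in> carrier A" "y \<in> carrier A"
    and "card {i. i < n \<and> i \<in> S} = m"
  shows "term_val A (\<lambda>i. if i \<in> S then x else y) u = x"
proof -
  \<comment> \<open>The variables \<open>0\<close> and \<open>1\<close> are distinct even when the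
    values \<open>x\<close> and \<open>y\<close> coincide.\<close>
  define v where "v i = (if i \<in> S then 0 else 1 :: nat)" for i :: nat
  define \<alpha> where "\<alpha> j = (if j = 0 then x else y)" for j :: nat
  have "{i. i < n \<and> v i = 0} = {i. i < n \<and> i \<in> S}" by (auto simp: v_def)
  then have "card {i. i < n \<and> v i = 0} = m" using assms(4) by simp
  moreover have "\<forall>i<n. v i \<in> {0, 1}" by (simp add: v_def)
  ultimately have "holds_eq A (term_subst (\<lambda>i. Var (v i)) u) (Var 0)"
    using assms(1) unfolding exact_majority_in_def by (metis zero_neq_one)
  moreover have "range \<alpha> \<subseteq> carrier A" using assms(2,3) by (auto simp: \<alpha>_def)
  ultimately have "term_val A (\<alpha> \<circ> v) u = \<alpha> 0"
    unfolding holds_eq_def term_val_subst_Var by fastforce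
  moreover have "\<alpha> \<circ> v = (\<lambda>i. if i \<in> S then x else y)" by (auto simp: \<alpha>_def v_def)
  ultimately show ?thesis by (simp add: \<alpha>_def)
qed

lemma block_val_first_majority:
  assumes "exact_majority_in m n u A" "x \<in> carrier A" "y \<in> carrier A" "m \<le> n"
  shows "block_val A u m m x y y = x"
proof -
  have "{i. i < n \<and> i \<in> {..<m}} = {..<m}" using assms(4) by auto
  then show ?thesis
    using exact_majority_val[OF assms(1-3), of "{..<m}"] by (simp add: block_val_def cong: if_cong)
qed

lemma block_val_last_majority:
  assumes "exact_majority_in m n u A" "x \<in> carrier A" "y \<in> carrier A" "m \<le> n"
  shows "block_val A u (n - m) (n - m) x y y = y"
proof -
  have "{i. i < n \<and> i \<in> {n - m..}} = {n - m..<n}" by auto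
  moreover have "(\<lambda>i. if i \<in> {n - m..} then y else x) = (\<lambda>i. if i < n - m then x else y)"
    by auto
  ultimately show ?thesis
    using exact_majority_val[OF assms(1,3,2), of "{n - m..}"] assms(4)
    by (simp add: block_val_def cong: if_cong)
qed

text \<open>The outer blocks have \<open>s\<close> and \<open>n - (s + (n - m)) = m - s\<close>
  places, together exactly \<open>m\<close>.\<close>

lemma block_val_outer_majority:
  assumes "exact_majority_in m n u A" "x \<in> carrier A" "y \<in> carrier A" "m \<le> n" "s \<le> m"
  shows "block_val A u s (s + (n - m)) x y x = x"
proof -
  let ?S = "{i. i < s \<or> s + (n - m) \<le> i}"
  have "{i. i < n \<and> i \<in> ?S} = {..<s} \<union> {s + (n - m)..<n}" using assms(4,5) by auto
  moreover have "card ({..<s} \<union> {s + (n - m)..<n}) = card {..<s} + card {s + (n - m)..<n}"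
    by (rule card_Un_disjoint) auto
  ultimately have "card {i. i < n \<and> i \<in> ?S} = m" using assms(4,5) by simp
  moreover have "(\<lambda>i. if i \<in> ?S then x else y) =
      (\<lambda>i. if i < s then x else if i < s + (n - m) then y else x)"
    using assms(4) by (intro ext) simp
  ultimately show ?thesis
    using exact_majority_val[OF assms(1-3), of ?S] by (simp add: block_val_def)
qed

text \<open>The elements \<open>?H s\<close> lead from \<open>a\<close> to \<open>c\<close> inside
  one \<theta>-class. Transitivity of \<open>R\<close> is avoided: each \<open>R\<close>-step used
  joins two elements \<alpha>-related to \<open>a\<close>, so it lies in
  \<open>\<alpha> \<inter> R\<close> and becomes a \<theta>-step at once.\<close>

lemma exact_majority_shifting:
  assumes maj: "exact_majority_in m n u A" and wf: "wf_term ar u" and mn: "m < n"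
    and \<alpha>: "is_congruence ar A \<alpha>" and \<theta>: "is_congruence ar A \<theta>" and R: "tolerance ar A R"
    and sub: "\<alpha> \<inter> R \<subseteq> \<theta>" and le: "\<theta> \<subseteq> \<alpha>"
    and ac: "(a, c) \<in> \<alpha>" and ab: "(a, b) \<in> R" and bd: "(b, d) \<in> \<theta>" and cd: "(c, d) \<in> R"
  shows "(a, c) \<in> \<theta>"
proof -
  define k where "k = n - m"
  have k: "k > 0" using mn by (simp add: k_def)
  note tol\<alpha> = \<alpha>[unfolded is_congruence_iff, THEN conjunct1]
    and tol\<theta> = \<theta>[unfolded is_congruence_iff, THEN conjunct1]
  have trans\<alpha>: "(x, z) \<in> \<alpha>" if "(x, y) \<in> \<alpha>" "(y, z) \<in> \<alpha>" for x y z
    using \<alpha> that unfolding is_congruence_iff by (blast dest: transD)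
  have trans\<theta>: "(x, z) \<in> \<theta>" if "(x, y) \<in> \<theta>" "(y, z) \<in> \<theta>" for x y z
    using \<theta> that unfolding is_congruence_iff by (blast dest: transD)
  have car: "a \<in> carrier A" "b \<in> carrier A" "c \<in> carrier A" "d \<in> carrier A"
    using tolerance_carrier[OF R ab] tolerance_carrier[OF R cd] by auto
  note r\<alpha> = tolerance_refl[OF tol\<alpha>] and r\<theta> = tolerance_refl[OF tol\<theta>] and rR = tolerance_refl[OF R]
  have ca: "(c, a) \<in> \<alpha>" using tolerance_sym[OF tol\<alpha> ac] .
  have cong_\<theta>: "(x, y) \<in> \<theta>" if "(x, y) \<in> R" "(x, a) \<in> \<alpha>" "(y, a) \<in> \<alpha>" for x y
    using that sub trans\<alpha> tolerance_sym[OF tol\<alpha>] by blast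
  let ?H = "\<lambda>s. block_val A u s s a c c"
  have step: "(?H (s + k), ?H s) \<in> \<theta>" if "s \<le> m" for s
  proof -
    let ?t = "\<lambda>y z. block_val A u s (s + k) a y z"
    \<comment> \<open>Changing the last argument from \<open>c\<close> to \<open>a\<close> is an
      \<alpha>-step, and it leaves \<open>a\<close> in both outer blocks.\<close>
    have near_a: "(?t y c, a) \<in> \<alpha>" if "y \<in> carrier A" for y
    proof -
      have "(?t y c, ?t y a) \<in> \<alpha>"
        by (intro tolerance_block_val[OF tol\<alpha> wf] r\<alpha> ca car that)
      moreover have "?t y a = a"
        using block_val_outer_majority[OF maj car(1) that, of s] mn \<open>s \<le> m\<close>
        by (simp add: k_def)
      ultimately show ?thesis by simp
    qed
    \<comment> \<open>The middle argument travels from \<open>a\<close> by \<open>R\<close> to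
      \<open>b\<close>, by \<theta> to \<open>d\<close>, by \<open>R\<close> to
      \<open>c\<close>.\<close>
    have "(?t a c, ?t b c) \<in> \<theta>"
      by (intro cong_\<theta> near_a car tolerance_block_val[OF R wf] rR ab)
    moreover have "(?t b c, ?t d c) \<in> \<theta>"
      by (intro tolerance_block_val[OF tol\<theta> wf] r\<theta> car bd)
    moreover have "(?t d c, ?t c c) \<in> \<theta>"
      by (intro cong_\<theta> near_a car tolerance_block_val[OF R wf] rR tolerance_sym[OF R cd])
    ultimately have "(?t a c, ?t c c) \<in> \<theta>" using trans\<theta> by blast
    then show ?thesis
      using block_val_collapse_left[of s "s + k" A u a c] block_val_collapse_right[of A u s "s + k" a c]
      by simp
  qed
  have descent: "(a, ?H (m - i * k)) \<in> \<theta>" if "i * k \<le> m" for i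
    using that
  proof (induction i)
    case 0
    then show ?case using block_val_first_majority[OF maj car(1,3)] mn r\<theta> car by simp
  next
    case (Suc i)
    then have "(a, ?H (m - i * k)) \<in> \<theta>" by simp
    \<comment> \<open>The truncated subtraction is exact here because
      \<open>Suc i * k \<le> m\<close>.\<close>
    moreover have "m - Suc i * k + k = m - i * k"
      using Suc.prems unfolding mult_Suc by linarith
    ultimately show ?case using step[of "m - Suc i * k"] trans\<theta> by (metis diff_le_self)
  qed
  define r where "r = m mod k"
  have r: "r \<le> k" using k by (simp add: r_def less_imp_le)
  have "m - m div k * k = r" by (simp add: r_def minus_div_mult_eq_mod)
  then have "(a, ?H r) \<in> \<theta>" using descent[of "m div k"] by simp
  moreover have "(?H r, c) \<in> \<theta>"
  proof -
    let ?p = "block_val A u r k"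
    \<comment> \<open>The middle block of \<open>?p\<close> has \<open>k - r\<close> places,
      possibly fewer than \<open>k\<close>, so the outer majority may fail. Instead,
      \<open>x\<close> fills the first \<open>k\<close> places and leaves exactly the last
      \<open>m\<close> to \<open>z\<close>.\<close>
    have p: "?p x x z = z" if "x \<in> carrier A" "z \<in> carrier A" for x z
      using trans[OF block_val_collapse_left[OF r] block_val_last_majority[OF maj that, folded k_def]]
        mn by simp
    have H: "?H r = ?p a c c" by (rule block_val_collapse_right[symmetric])
    \<comment> \<open>By \<open>p\<close> the right-hand sides of this \<alpha>-step and the next
      are both \<open>a\<close>. Hence the \<open>R\<close>-related elements \<open>?p a c c\<close>
      and \<open>?p b d c\<close> are \<theta>-related, and replacing \<open>d\<close> by
      \<open>b\<close> then reaches \<open>?p b b c = c\<close>.\<close>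
    have "(?p a c c, ?p a a a) \<in> \<alpha>"
      by (intro tolerance_block_val[OF tol\<alpha> wf] r\<alpha> car ca)
    moreover have "(?p b d c, ?p b b a) \<in> \<alpha>"
      by (intro tolerance_block_val[OF tol\<alpha> wf] r\<alpha> car ca)
        (use bd le tolerance_sym[OF tol\<alpha>] in blast)
    moreover have "(?p a c c, ?p b d c) \<in> R"
      by (intro tolerance_block_val[OF R wf] ab cd rR car)
    ultimately have "(?p a c c, ?p b d c) \<in> \<theta>" using cong_\<theta> p car by simp
    moreover have "(?p b d c, ?p b b c) \<in> \<theta>"
      by (intro tolerance_block_val[OF tol\<theta> wf] r\<theta> car tolerance_sym[OF tol\<theta> bd])
    ultimately show ?thesis using trans\<theta> H p car by metis
  qed
  ultimately show ?thesis using trans\<theta> by blast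
qed

section \<open>Modularity\<close>

text \<open>An upper bound \<open>J\<close> of \<beta> and \<theta> serves the modular law as well
  as the join, which lies below it. The bound on \<open>\<alpha> \<inter> J\<close> is proved along
  the chain whose union is \<open>J\<close>.\<close>

lemma ex_join_below_modular:
  assumes maj: "exact_majority_in m n u A" and wf: "wf_term ar u" and mn: "m < n"
    and \<alpha>: "is_congruence ar A \<alpha>" and \<beta>: "is_congruence ar A \<beta>" and \<theta>: "is_congruence ar A \<theta>"
    and sub: "\<alpha> \<inter> \<beta> \<subseteq> \<theta>" and le: "\<theta> \<subseteq> \<alpha>"
  shows "\<exists>J. is_congruence ar A J \<and> \<beta> \<subseteq> J \<and> \<theta> \<subseteq> J \<and> \<alpha> \<inter> J \<subseteq> \<theta>"
proof -
  define R where "R = rec_nat \<beta> (\<lambda>_ S. S O \<theta> O S)"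
  have R0: "R 0 = \<beta>" and RSuc: "R (Suc j) = R j O \<theta> O R j" for j
    by (simp_all add: R_def)
  have tol\<alpha>: "tolerance ar A \<alpha>" and tol\<theta>: "tolerance ar A \<theta>"
    using \<alpha> \<theta> by (simp_all add: is_congruence_iff)
  have tol: "tolerance ar A (R j)" for j
    by (induction j) (use \<beta> tol\<theta> in \<open>auto simp: R0 RSuc is_congruence_iff intro: tolerance_relcomp_sandwich\<close>)
  \<comment> \<open>A trivial \<theta>-step is inserted in the middle; this is what makes the union
    transitive.\<close>
  have comp: "R j O R j \<subseteq> R (Suc j)" for j
    using tolerance_carrier[OF tol] tolerance_refl[OF tol\<theta>] unfolding RSuc by blast
  have "R j \<subseteq> R (Suc j)" for j
  proof clarify
    fix x y
    assume "(x, y) \<in> R j"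
    then show "(x, y) \<in> R (Suc j)"
      using comp[of j] tolerance_refl[OF tol] tolerance_carrier[OF tol] by blast
  qed
  then have mono: "mono R" by (rule mono_iff_le_Suc[THEN iffD2, OF allI])
  let ?J = "\<Union>j. R j"
  have "trans ?J"
  proof (rule transI)
    fix x y z
    assume "(x, y) \<in> ?J" "(y, z) \<in> ?J"
    then obtain i j where "(x, y) \<in> R i" "(y, z) \<in> R j" by blast
    moreover have "R i \<subseteq> R (max i j)" "R j \<subseteq> R (max i j)"
      by (simp_all add: monoD[OF mono])
    ultimately show "(x, z) \<in> ?J" using comp[of "max i j"] by blast
  qed
  then have "is_congruence ar A ?J"
    by (simp add: is_congruence_iff tolerance_chain_Union[OF mono tol])
  moreover have "\<theta> \<subseteq> R (Suc 0)"
  proof clarify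
    fix x y
    assume "(x, y) \<in> \<theta>"
    then show "(x, y) \<in> R (Suc 0)"
      using tolerance_carrier[OF tol\<theta>] tolerance_refl[OF tol] unfolding RSuc by (meson relcompI)
  qed
  \<comment> \<open>The induction hypothesis is the premise \<open>sub\<close> of the shifting lemma
    for the tolerance \<open>R j\<close>; a pair in \<open>R (Suc j)\<close> supplies its other two
    corners \<open>b\<close> and \<open>d\<close>.\<close>
  moreover have "\<alpha> \<inter> R j \<subseteq> \<theta>" for j
  proof (induction j)
    case 0
    then show ?case using sub R0 by simp
  next
    case (Suc j)
    show ?case
    proof clarify
      fix a c
      assume ac: "(a, c) \<in> \<alpha>" and "(a, c) \<in> R (Suc j)"
      then obtain b d where "(a, b) \<in> R j" "(b, d) \<in> \<theta>" "(d, c) \<in> R j"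
        unfolding RSuc by blast
      then show "(a, c) \<in> \<theta>"
        using exact_majority_shifting[OF maj wf mn \<alpha> \<theta> tol Suc le ac] tolerance_sym[OF tol]
        by blast
    qed
  qed
  ultimately show ?thesis using R0 by blast
qed

section \<open>The congruence lattice and its modular law\<close>

lemma is_congruence_Inter:
  assumes "T \<noteq> {}" and "\<And>\<theta>. \<theta> \<in> T \<Longrightarrow> is_congruence ar A \<theta>"
  shows "is_congruence ar A (\<Inter>T)"
proof -
  have tol: "tolerance ar A \<theta>" and tr: "trans \<theta>" if "\<theta> \<in> T" for \<theta>
    using assms(2)[OF that] by (simp_all add: is_congruence_iff)
  have "tolerance ar A (\<Inter>T)"
    unfolding tolerance_def
  proof (intro conjI allI impI)
    \<comment> \<open>Since \<open>\<Inter>{}\<close> is \<open>UNIV\<close>, this is where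
      \<open>T \<noteq> {}\<close> enters.\<close>
    show "\<Inter>T \<subseteq> carrier A \<times> carrier A"
      using assms(1) tol unfolding tolerance_def by blast
    show "refl_on (carrier A) (\<Inter>T)"
      by (auto intro!: refl_onI tolerance_refl[OF tol])
    show "sym (\<Inter>T)"
      by (auto intro!: symI intro: tolerance_sym[OF tol])
  next
    fix f xs ys
    assume *: "length xs = ar f \<and> list_all2 (\<lambda>x y. (x, y) \<in> \<Inter>T) xs ys"
    show "(opn A f xs, opn A f ys) \<in> \<Inter>T"
    proof
      fix \<theta>
      assume "\<theta> \<in> T"
      moreover from this * have "list_all2 (\<lambda>x y. (x, y) \<in> \<theta>) xs ys"
        by (auto elim: list_all2_mono)
      ultimately show "(opn A f xs, opn A f ys) \<in> \<theta>" using * tolerance_opn[OF tol] by blast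
    qed
  qed
  moreover have "trans (\<Inter>T)" using tr by (blast intro: transI dest: transD)
  ultimately show ?thesis by (simp add: is_congruence_iff)
qed

lemma is_congruence_full:
  assumes "is_ualgebra ar A"
  shows "is_congruence ar A (carrier A \<times> carrier A)"
proof -
  have "set xs \<subseteq> carrier A \<and> set ys \<subseteq> carrier A"
    if "list_all2 (\<lambda>x y. (x, y) \<in> carrier A \<times> carrier A) xs ys" for xs ys
    using that by (induction rule: list_all2_induct) auto
  then have "(opn A f xs, opn A f ys) \<in> carrier A \<times> carrier A"
    if "length xs = ar f" "list_all2 (\<lambda>x y. (x, y) \<in> carrier A \<times> carrier A) xs ys" for f xs ys
    using assms that list_all2_lengthD[OF that(2)] unfolding is_ualgebra_def by simp
  moreover have "equiv (carrier A) (carrier A \<times> carrier A)"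
    by (auto intro!: equivI refl_onI symI transI)
  ultimately show ?thesis unfolding is_congruence_def by blast
qed

lemma carrier_Con [simp]: "\<theta> \<in> carrier (Con ar A) \<longleftrightarrow> is_congruence ar A \<theta>"
  by (simp add: Con_def)

lemma le_Con [simp]: "\<theta> \<sqsubseteq>\<^bsub>Con ar A\<^esub> \<psi> \<longleftrightarrow> \<theta> \<subseteq> \<psi>"
  by (simp add: Con_def)

lemma lattice_Con:
  assumes "is_ualgebra ar A"
  shows "lattice (Con ar A)"
proof -
  let ?L = "Con ar A"
  interpret partial_order ?L
    by unfold_locales (auto simp: Con_def)
  show ?thesis
  proof unfold_locales
    fix x y
    assume xy: "x \<in> carrier ?L" "y \<in> carrier ?L"
    let ?T = "{\<theta>. is_congruence ar A \<theta> \<and> x \<subseteq> \<theta> \<and> y \<subseteq> \<theta>}"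
    \<comment> \<open>The full relation makes the family of upper bounds nonempty, so its
      intersection is a congruence, the join.\<close>
    have "carrier A \<times> carrier A \<in> ?T"
      using xy is_congruence_full[OF assms] by (auto simp: is_congruence_def equiv_def)
    then have "is_congruence ar A (\<Inter>?T)"
      by (intro is_congruence_Inter) auto
    then have "least ?L (\<Inter>?T) (Upper ?L {x, y})"
      using xy by (auto simp: least_def Upper_def)
    then show "\<exists>s. least ?L s (Upper ?L {x, y})" ..
    have "is_congruence ar A (x \<inter> y)"
      using is_congruence_Inter[of "{x, y}" ar A] xy by auto
    then have "greatest ?L (x \<inter> y) (Lower ?L {x, y})"
      using xy by (auto simp: greatest_def Lower_def)
    then show "\<exists>s. greatest ?L s (Lower ?L {x, y})" ..
  qed
qed

lemma modular_lattice_Con: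
  assumes alg: "is_ualgebra ar A" and maj: "exact_majority_in m n u A" and wf: "wf_term ar u"
    and mn: "m < n"
  shows "modular_lattice (Con ar A)"
proof -
  let ?L = "Con ar A"
  interpret lattice ?L by (rule lattice_Con[OF alg])
  show ?thesis
  proof unfold_locales
    fix x y z
    assume L: "x \<in> carrier ?L" "y \<in> carrier ?L" "z \<in> carrier ?L" and xz: "x \<sqsubseteq>\<^bsub>?L\<^esub> z"
    let ?\<theta> = "x \<squnion>\<^bsub>?L\<^esub> (y \<sqinter>\<^bsub>?L\<^esub> z)" and ?M = "(x \<squnion>\<^bsub>?L\<^esub> y) \<sqinter>\<^bsub>?L\<^esub> z"
    have carrier: "y \<sqinter>\<^bsub>?L\<^esub> z \<in> carrier ?L" "x \<squnion>\<^bsub>?L\<^esub> y \<in> carrier ?L" "?\<theta> \<in> carrier ?L" "?M \<in> carrier ?L"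
      using L by (simp_all del: carrier_Con)
    have join_xy: "x \<subseteq> x \<squnion>\<^bsub>?L\<^esub> y" "y \<subseteq> x \<squnion>\<^bsub>?L\<^esub> y"
      using join_left[OF L(1,2)] join_right[OF L(1,2)] by simp_all
    have meet_yz: "y \<sqinter>\<^bsub>?L\<^esub> z \<subseteq> y" "y \<sqinter>\<^bsub>?L\<^esub> z \<subseteq> z"
      using meet_left[OF L(2,3)] meet_right[OF L(2,3)] by simp_all
    have \<theta>_ge: "x \<subseteq> ?\<theta>" "y \<sqinter>\<^bsub>?L\<^esub> z \<subseteq> ?\<theta>"
      using join_left[OF L(1) carrier(1)] join_right[OF L(1) carrier(1)] by simp_all
    have \<theta>_le: "?\<theta> \<subseteq> w" if "w \<in> carrier ?L" "x \<subseteq> w" "y \<sqinter>\<^bsub>?L\<^esub> z \<subseteq> w" for w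
      using join_le[OF _ _ L(1) carrier(1) that(1)] that(2,3) by simp
    have M: "?M \<subseteq> x \<squnion>\<^bsub>?L\<^esub> y" "?M \<subseteq> z"
      using meet_left[OF carrier(2) L(3)] meet_right[OF carrier(2) L(3)] by simp_all
    have "?\<theta> \<subseteq> ?M"
    proof -
      have "?\<theta> \<subseteq> x \<squnion>\<^bsub>?L\<^esub> y" "?\<theta> \<subseteq> z"
        using \<theta>_le join_xy meet_yz xz carrier(2) L(3) by auto
      then show ?thesis using meet_le[OF _ _ carrier(2) L(3) carrier(3)] by simp
    qed
    moreover have "?M \<subseteq> ?\<theta>"
    proof -
      \<comment> \<open>The lattice meet is known only as a greatest lower bound; the congruence
        \<open>z \<inter> y\<close> is a lower bound, hence below it.\<close>
      have int: "z \<inter> y \<in> carrier ?L"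
        using is_congruence_Inter[of "{z, y}" ar A] L by auto
      then have "z \<inter> y \<subseteq> ?\<theta>"
        using meet_le[OF _ _ L(2,3) int] \<theta>_ge(2) by auto
      moreover have "?\<theta> \<subseteq> z" using \<theta>_le[of z] L meet_yz xz by simp
      \<comment> \<open>The roles of \<alpha>, \<beta>, \<theta> are taken by \<open>z\<close>,
        \<open>y\<close> and \<open>?\<theta>\<close>. As \<open>J\<close> also contains
        \<open>x\<close>, it bounds the join of \<open>x\<close> and \<open>y\<close>.\<close>
      ultimately obtain J where J: "is_congruence ar A J" "y \<subseteq> J" "?\<theta> \<subseteq> J" "z \<inter> J \<subseteq> ?\<theta>"
        using ex_join_below_modular[OF maj wf mn, of z y ?\<theta>] L carrier(3) by auto
      then have "x \<squnion>\<^bsub>?L\<^esub> y \<subseteq> J"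
        using join_le[OF _ _ L(1,2), of J] \<theta>_ge(1) by auto
      then show ?thesis using M J(4) by blast
    qed
    ultimately show "?\<theta> = ?M" by (rule subset_antisym)
  qed
qed

theorem theorem5:
  fixes n m :: nat
    and ar :: "'f \<Rightarrow> nat"
    and V :: "('a, 'f) ualgebra set"
  assumes "n \<ge> 3" and "0 < m" and "m < n"
    and "variety ar V"
    and "\<exists>u. exact_majority_term ar m n u V"
  shows "congruence_modular ar V"
proof -
  obtain u where u: "wf_term ar u" "\<And>A. A \<in> V \<Longrightarrow> exact_majority_in m n u A"
    using assms(5) unfolding exact_majority_term_def nary_term_def by blast
  have "is_ualgebra ar A" if "A \<in> V" for A
    using assms(4) that unfolding variety_def by blast
  then show ?thesis
    unfolding congruence_modular_def using modular_lattice_Con u assms(3) by blast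
qed

end
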